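(* Let $m,n\ge 2$ be integers. The center $\mathcal Z(G_{m,n})$ of the group $G_{m,n}$ is isomorphic to $\mathbb Z$ and is generated by $\Delta:=s\,t_1\cdots t_m\,u_1\cdots u_n$.
   Context: For letters $x_1,\dots,x_k$, the symbol $[x_1,x_2,\dots,x_k]$ denotes the cyclic relations $x_1x_2\cdots x_k=x_2\cdots x_kx_1=x_3\cdots x_kx_1x_2=\cdots=x_kx_1\cdots x_{k-1}$ (all cyclic rotations of the word are equal); in particular $[x,y]$ denotes $xy=yx$. $G_{m,n}$ is the group presented by the generators $s,t_1,\dots,t_m,u_1,\dots,u_n$ and the relations $[s,t_1,\dots,t_m]$, $[s,u_1,\dots,u_n]$, and $[t_i,u_j]$ for all $1\le i\le m$, $1\le j\le n$. *)

theory Defs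
  imports "HOL-Algebra.Elementary_Groups"
begin

section \<open>Groups given by generators and relations\<close>

text \<open>
  A letter \<open>(x, True)\<close> stands for the generator \<open>x\<close> and \<open>(x, False)\<close> for its formal
  inverse. A relation is a pair of words that are declared equal. The group presented by
  generators \<open>X\<close> and relations \<open>R\<close> consists of the classes of words modulo the smallest
  congruence that contains \<open>R\<close> and allows cancelling a letter against its inverse.
\<close>

type_synonym 'a word = "('a \<times> bool) list"

definition words_over :: "'a set \<Rightarrow> 'a word set" where
  "words_over X = {w. fst ` set w \<subseteq> X}"

inductive_set word_cong :: "'a set \<Rightarrow> ('a word \<times> 'a word) set \<Rightarrow> ('a word \<times> 'a word) set"
  for X :: "'a set" and R :: "('a word \<times> 'a word) set" where
  refl: "w \<in> words_over X \<Longrightarrow> (w, w) \<in> word_cong X R"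
| sym: "(v, w) \<in> word_cong X R \<Longrightarrow> (w, v) \<in> word_cong X R"
| trans: "(u, v) \<in> word_cong X R \<Longrightarrow> (v, w) \<in> word_cong X R \<Longrightarrow> (u, w) \<in> word_cong X R"
| cancel: "x \<in> X \<Longrightarrow> u \<in> words_over X \<Longrightarrow> v \<in> words_over X \<Longrightarrow>
    (u @ [(x, b), (x, \<not> b)] @ v, u @ v) \<in> word_cong X R"
| rel: "(r, r') \<in> R \<Longrightarrow> r \<in> words_over X \<Longrightarrow> r' \<in> words_over X \<Longrightarrow>
    u \<in> words_over X \<Longrightarrow> v \<in> words_over X \<Longrightarrow>
    (u @ r @ v, u @ r' @ v) \<in> word_cong X R"

definition word_class :: "'a set \<Rightarrow> ('a word \<times> 'a word) set \<Rightarrow> 'a word \<Rightarrow> 'a word set" where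
  "word_class X R w = word_cong X R `` {w}"

definition presented_group :: "'a set \<Rightarrow> ('a word \<times> 'a word) set \<Rightarrow> 'a word set monoid" where
  "presented_group X R =
    \<lparr>carrier = words_over X // word_cong X R,
     monoid.mult = (\<lambda>A B. \<Union>u\<in>A. \<Union>v\<in>B. word_class X R (u @ v)),
     one = word_class X R []\<rparr>"

definition positive_word :: "'a list \<Rightarrow> 'a word" where
  "positive_word xs = map (\<lambda>x. (x, True)) xs"

definition cyclic_relations :: "'a list \<Rightarrow> ('a word \<times> 'a word) set" where
  "cyclic_relations xs = {(positive_word xs, positive_word (rotate i xs)) | i. i < length xs}"


section \<open>The group $G_{m,n}$\<close>

datatype gen = Gs | Gt nat | Gu nat

definition ts :: "nat \<Rightarrow> gen list" where
  "ts m = map Gt [1..<Suc m]"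

definition us :: "nat \<Rightarrow> gen list" where
  "us n = map Gu [1..<Suc n]"

definition G_gens :: "nat \<Rightarrow> nat \<Rightarrow> gen set" where
  "G_gens m n = {Gs} \<union> Gt ` {1..m} \<union> Gu ` {1..n}"

definition G_rels :: "nat \<Rightarrow> nat \<Rightarrow> (gen word \<times> gen word) set" where
  "G_rels m n = cyclic_relations (Gs # ts m) \<union> cyclic_relations (Gs # us n) \<union>
     (\<Union>i\<in>{1..m}. \<Union>j\<in>{1..n}. cyclic_relations [Gt i, Gu j])"

definition Gmn :: "nat \<Rightarrow> nat \<Rightarrow> gen word set monoid" where
  "Gmn m n = presented_group (G_gens m n) (G_rels m n)"

definition Delta :: "nat \<Rightarrow> nat \<Rightarrow> gen word set" where
  "Delta m n = word_class (G_gens m n) (G_rels m n) (positive_word (Gs # ts m @ us n))"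

definition center :: "('a, 'b) monoid_scheme \<Rightarrow> 'a set" where
  "center H = {z \<in> carrier H. \<forall>x\<in>carrier H. z \<otimes>\<^bsub>H\<^esub> x = x \<otimes>\<^bsub>H\<^esub> z}"


section \<open>Basic properties of presented groups\<close>

lemma words_over_Nil [simp]: "[] \<in> words_over X"
  and words_over_Cons [simp]: "a # w \<in> words_over X \<longleftrightarrow> fst a \<in> X \<and> w \<in> words_over X"
  and words_over_append [simp]: "u @ v \<in> words_over X \<longleftrightarrow> u \<in> words_over X \<and> v \<in> words_over X"
  by (auto simp: words_over_def)

lemma word_cong_words: "(u, v) \<in> word_cong X R \<Longrightarrow> u \<in> words_over X \<and> v \<in> words_over X"
  by (induction rule: word_cong.induct) auto

lemma equiv_word_cong: "equiv (words_over X) (word_cong X R)"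
proof (rule equivI)
  show "word_cong X R \<subseteq> words_over X \<times> words_over X"
    using word_cong_words by fastforce
  show "refl_on (words_over X) (word_cong X R)"
    by (rule refl_onI) (rule word_cong.refl)
  show "sym (word_cong X R)" by (rule symI) (rule word_cong.sym)
  show "trans (word_cong X R)" by (rule transI) (rule word_cong.trans)
qed

lemma word_cong_context:
  assumes "(u, v) \<in> word_cong X R" "a \<in> words_over X" "b \<in> words_over X"
  shows "(a @ u @ b, a @ v @ b) \<in> word_cong X R"
  using assms
proof (induction rule: word_cong.induct)
  case (refl w)
  then show ?case by (intro word_cong.refl) simp
next
  case (sym v w)
  then show ?case by (blast intro: word_cong.sym)
next
  case (trans u v w)
  then show ?case by (blast intro: word_cong.trans)
next
  case (cancel x u v c)
  then show ?case using word_cong.cancel[of x X "a @ u" "v @ b" c R] by simp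
next
  case (rel r r' u v)
  then show ?case using word_cong.rel[of r r' R X "a @ u" "v @ b"] by simp
qed

lemma word_cong_append:
  assumes "(u, u') \<in> word_cong X R" "(v, v') \<in> word_cong X R"
  shows "(u @ v, u' @ v') \<in> word_cong X R"
proof -
  have "(u @ v, u' @ v) \<in> word_cong X R"
    using word_cong_context[of u u' X R "[]" v] assms word_cong_words by fastforce
  moreover have "(u' @ v, u' @ v') \<in> word_cong X R"
    using word_cong_context[of v v' X R u' "[]"] assms word_cong_words by fastforce
  ultimately show ?thesis by (rule word_cong.trans)
qed

lemma word_class_eq_iff:
  "u \<in> words_over X \<Longrightarrow> v \<in> words_over X \<Longrightarrow>
    word_class X R u = word_class X R v \<longleftrightarrow> (u, v) \<in> word_cong X R"
  unfolding word_class_def using equiv_word_cong by (metis eq_equiv_class_iff)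

lemma carrier_presented_group: "carrier (presented_group X R) = word_class X R ` words_over X"
  by (auto simp: presented_group_def word_class_def quotient_def)

lemma one_presented_group: "\<one>\<^bsub>presented_group X R\<^esub> = word_class X R []"
  by (simp add: presented_group_def)

lemma mult_presented_group:
  assumes "u \<in> words_over X" "v \<in> words_over X"
  shows "word_class X R u \<otimes>\<^bsub>presented_group X R\<^esub> word_class X R v = word_class X R (u @ v)"
proof -
  have "word_class X R (a @ b) = word_class X R (u @ v)"
    if "a \<in> word_class X R u" "b \<in> word_class X R v" for a b
  proof -
    have ab: "(u, a) \<in> word_cong X R" "(v, b) \<in> word_cong X R"
      using that by (simp_all add: word_class_def)
    then have "(a @ b, u @ v) \<in> word_cong X R"
      by (intro word_cong.sym[OF word_cong_append])
    then show ?thesis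
      by (subst word_class_eq_iff) (use assms ab[THEN word_cong_words] in auto)
  qed
  moreover have "u \<in> word_class X R u" "v \<in> word_class X R v"
    using assms by (auto simp: word_class_def intro: word_cong.refl)
  ultimately have "(\<Union>a\<in>word_class X R u. \<Union>b\<in>word_class X R v. word_class X R (a @ b)) =
      word_class X R (u @ v)"
    by blast
  then show ?thesis by (simp add: presented_group_def)
qed

definition inv_word :: "'a word \<Rightarrow> 'a word" where
  "inv_word w = rev (map (\<lambda>(x, b). (x, \<not> b)) w)"

lemma inv_word_words: "w \<in> words_over X \<Longrightarrow> inv_word w \<in> words_over X"
  by (induction w) (auto simp: inv_word_def)

lemma inv_word_cancel: "w \<in> words_over X \<Longrightarrow> (inv_word w @ w, []) \<in> word_cong X R"
proof (induction w)
  case Nil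
  then show ?case by (simp add: inv_word_def word_cong.refl)
next
  case (Cons a w)
  obtain x b where a: "a = (x, b)" by (cases a)
  have "(inv_word w @ [(x, \<not> b), (x, \<not> \<not> b)] @ w, inv_word w @ w) \<in> word_cong X R"
    using Cons.prems a by (intro word_cong.cancel) (auto simp: inv_word_words)
  then show ?case
    using Cons a by (auto simp: inv_word_def intro: word_cong.trans)
qed

lemma group_presented_group: "group (presented_group X R)"
proof (rule groupI)
  fix A assume "A \<in> carrier (presented_group X R)"
  then obtain w where w: "w \<in> words_over X" "A = word_class X R w"
    by (auto simp: carrier_presented_group)
  have "word_class X R (inv_word w) \<otimes>\<^bsub>presented_group X R\<^esub> A = \<one>\<^bsub>presented_group X R\<^esub>"
    using w inv_word_cancel[OF w(1)]
    by (simp add: mult_presented_group inv_word_words one_presented_group word_class_eq_iff)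
  then show "\<exists>B\<in>carrier (presented_group X R).
      B \<otimes>\<^bsub>presented_group X R\<^esub> A = \<one>\<^bsub>presented_group X R\<^esub>"
    using w inv_word_words by (force simp: carrier_presented_group)
qed (auto simp: carrier_presented_group one_presented_group mult_presented_group)

definition eval_word :: "('g, 'b) monoid_scheme \<Rightarrow> ('a \<Rightarrow> 'g) \<Rightarrow> 'a word \<Rightarrow> 'g" where
  "eval_word H f w =
    foldr (\<lambda>(x, b) g. (if b then f x else inv\<^bsub>H\<^esub> (f x)) \<otimes>\<^bsub>H\<^esub> g) w \<one>\<^bsub>H\<^esub>"

lemma (in group) eval_word_closed:
  "f \<in> X \<rightarrow> carrier G \<Longrightarrow> w \<in> words_over X \<Longrightarrow> eval_word G f w \<in> carrier G"
  by (induction w) (auto simp: eval_word_def Pi_iff)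

lemma (in group) eval_word_append:
  assumes "f \<in> X \<rightarrow> carrier G" "u \<in> words_over X" "v \<in> words_over X"
  shows "eval_word G f (u @ v) = eval_word G f u \<otimes> eval_word G f v"
  using assms(2)
proof (induction u)
  case Nil
  then show ?case using eval_word_closed[OF assms(1,3)] by (simp add: eval_word_def)
next
  case (Cons a u)
  then show ?case
    using assms(1) eval_word_closed[OF assms(1,3)] eval_word_closed[OF assms(1), of u]
    by (cases a) (auto simp: eval_word_def Pi_iff m_assoc)
qed

lemma (in group) eval_word_cong:
  assumes "f \<in> X \<rightarrow> carrier G"
    and "\<And>r r'. (r, r') \<in> R \<Longrightarrow> r \<in> words_over X \<Longrightarrow> r' \<in> words_over X \<Longrightarrow>
          eval_word G f r = eval_word G f r'"
    and "(u, v) \<in> word_cong X R"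
  shows "eval_word G f u = eval_word G f v"
  using assms(3)
proof (induction rule: word_cong.induct)
  case (cancel x u v b)
  have fx: "f x \<in> carrier G" using assms(1) cancel by auto
  have "eval_word G f [(x, b), (x, \<not> b)] = \<one>"
    using fx by (simp add: eval_word_def)
  then show ?case
    using cancel eval_word_closed[OF assms(1)]
    by (simp add: eval_word_append[OF assms(1)] del: append_Cons)
next
  case (rel r r' u v)
  then show ?case
    by (simp add: eval_word_append[OF assms(1)] assms(2)[of r r'])
qed auto

lemma (in group) presented_group_hom:
  assumes f: "f \<in> X \<rightarrow> carrier G"
    and R: "\<And>r r'. (r, r') \<in> R \<Longrightarrow> r \<in> words_over X \<Longrightarrow> r' \<in> words_over X \<Longrightarrow>
          eval_word G f r = eval_word G f r'"
  shows "\<exists>h\<in>hom (presented_group X R) G.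
    \<forall>w\<in>words_over X. h (word_class X R w) = eval_word G f w"
proof -
  define h where "h A = eval_word G f (SOME w. w \<in> A)" for A
  have h: "h (word_class X R w) = eval_word G f w" if "w \<in> words_over X" for w
  proof -
    have "w \<in> word_class X R w"
      using that by (simp add: word_class_def word_cong.refl)
    then have "(SOME v. v \<in> word_class X R w) \<in> word_class X R w"
      by (rule someI)
    then have "(w, SOME v. v \<in> word_class X R w) \<in> word_cong X R"
      by (simp add: word_class_def)
    from eval_word_cong[OF f R this] show ?thesis by (simp add: h_def)
  qed
  have "h \<in> hom (presented_group X R) G"
    by (rule homI)
      (auto simp: carrier_presented_group h mult_presented_group eval_word_closed[OF f]
        eval_word_append[OF f])
  with h show ?thesis by blast
qed

end

(* Since s = \<Delta> (u_1 ... u_n)^-1 (t_1 ... t_m)^-1 with \<Delta> central, the group is generated by \<Delta>, the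
   t_i and the u_j, and it is the direct product of the infinite cyclic group on \<Delta> and the free
   groups on the t_i and on the u_j. Both free groups have rank at least two, hence trivial centers.
   To avoid constructing the isomorphism, every element is written as \<Delta>^k a b with a a word in the
   t_i and b a word in the u_j, and the factors are separated by homomorphisms onto the
   free groups and onto the integers. *)
theory Submission
  imports Defs
begin

text \<open>All rotations of a word agree exactly when its product commutes with each of its
  letters. This reformulation is used in both directions: inside the group it turns the relations
  into commutation, and for a map on generators it is the test that the relations are respected.
  With T and U the products of the \<open>t_i\<close> and of the \<open>u_j\<close>,
  \<open>s T\<close> commutes with \<open>s\<close> and all \<open>t_i\<close>, \<open>s U\<close>
  commutes with \<open>s\<close> and all \<open>u_j\<close>, and Delta is both
  \<open>(s T) U\<close> and \<open>(s U) T\<close>; centrality follows one generator at a time. The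
  projection onto a free factor has to kill Delta, which forces \<open>s\<close> to go to the
  inverse of the product of the generators kept. The map to the integers counts \<open>s\<close>, so
  Delta goes to 1 and has infinite order. Triviality travels back from a free factor because free
  cancellation is also valid under the relations of \<open>Gmn\<close>. The bounds on
  \<open>m\<close> and \<open>n\<close> supply two distinct generators in each factor; a factor of
  rank one would be infinite cyclic and would enlarge the center.\<close>

lemma words_over_mono: "w \<in> words_over X \<Longrightarrow> X \<subseteq> Y \<Longrightarrow> w \<in> words_over Y"
  by (auto simp: words_over_def)

lemma positive_word_append: "positive_word (xs @ ys) = positive_word xs @ positive_word ys"
  by (simp add: positive_word_def)

lemma positive_word_words [simp]: "positive_word xs \<in> words_over X \<longleftrightarrow> set xs \<subseteq> X"
  by (auto simp: words_over_def positive_word_def image_iff)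

text \<open>Adding generators and relations only identifies more words. This later carries
  triviality from a free group into \<open>Gmn\<close>.\<close>

lemma word_cong_mono:
  assumes "(u, v) \<in> word_cong X R" "X \<subseteq> Y" "R \<subseteq> S"
  shows "(u, v) \<in> word_cong Y S"
  using assms(1)
proof (induction rule: word_cong.induct)
  case (refl w)
  then show ?case using assms by (auto intro: word_cong.refl words_over_mono)
next
  case (sym v w)
  then show ?case by (blast intro: word_cong.sym)
next
  case (trans u v w)
  then show ?case by (blast intro: word_cong.trans)
next
  case (cancel x u v b)
  then show ?case using assms by (intro word_cong.cancel) (auto intro: words_over_mono)
next
  case (rel r r' u v)
  then show ?case using assms by (intro word_cong.rel) (auto intro: words_over_mono)
qed

section \<open>Commuting elements and evaluation of words\<close>

context group
begin

lemma commute_mult: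
  assumes "x \<in> carrier G" "y \<in> carrier G" "z \<in> carrier G"
    and "x \<otimes> y = y \<otimes> x" "x \<otimes> z = z \<otimes> x"
  shows "x \<otimes> (y \<otimes> z) = (y \<otimes> z) \<otimes> x"
proof -
  have "x \<otimes> (y \<otimes> z) = (y \<otimes> x) \<otimes> z" using assms by (simp add: m_assoc[symmetric])
  also have "\<dots> = y \<otimes> (z \<otimes> x)" using assms by (simp add: m_assoc)
  finally show ?thesis using assms by (simp add: m_assoc)
qed

lemma commute_inv:
  assumes "x \<in> carrier G" "y \<in> carrier G" "x \<otimes> y = y \<otimes> x"
  shows "x \<otimes> inv y = inv y \<otimes> x"
proof -
  have "inv y \<otimes> x = inv y \<otimes> ((x \<otimes> y) \<otimes> inv y)" using assms(1,2) by (simp add: m_assoc)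
  also have "\<dots> = x \<otimes> inv y" using assms by (simp add: m_assoc[symmetric])
  finally show ?thesis by simp
qed

lemma commute_int_pow:
  fixes k :: int
  assumes "x \<in> carrier G" "y \<in> carrier G" "x \<otimes> y = y \<otimes> x"
  shows "x \<otimes> (y [^] k) = (y [^] k) \<otimes> x"
proof -
  have nat: "x \<otimes> (y [^] j) = (y [^] j) \<otimes> x" for j :: nat
  proof (induction j)
    case (Suc j)
    show ?case
      unfolding nat_pow_Suc by (rule commute_mult) (use assms Suc in auto)
  next
    case 0
    show ?case using assms(1) by simp
  qed
  show ?thesis
    unfolding int_pow_def2
    using nat commute_inv[OF assms(1) nat_pow_closed[OF assms(2)] nat] by (simp only: split: if_split) blast
qed

text \<open>The centralizer of \<open>g\<close> is closed under products and inverses, so the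
  generators decide.\<close>

lemma eval_word_commute:
  assumes "f \<in> X \<rightarrow> carrier G" "g \<in> carrier G" "\<And>x. x \<in> X \<Longrightarrow> g \<otimes> f x = f x \<otimes> g"
    and "w \<in> words_over X"
  shows "g \<otimes> eval_word G f w = eval_word G f w \<otimes> g"
  using assms(4)
proof (induction w)
  case Nil
  then show ?case using assms by (simp add: eval_word_def)
next
  case (Cons a w)
  obtain x b where a: "a = (x, b)" by (cases a)
  have x: "f x \<in> carrier G" "g \<otimes> f x = f x \<otimes> g" using Cons assms a by auto
  have w: "eval_word G f w \<in> carrier G" "g \<otimes> eval_word G f w = eval_word G f w \<otimes> g"
    using Cons eval_word_closed[OF assms(1)] by auto
  have "eval_word G f (a # w) = (if b then f x else inv f x) \<otimes> eval_word G f w"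
    by (simp add: a eval_word_def)
  then show ?case
    using commute_mult[OF assms(2) _ w(1) _ w(2)] commute_inv[OF assms(2) x] x by simp
qed

lemma eval_word_trivial:
  "w \<in> words_over X \<Longrightarrow> (\<And>x. x \<in> X \<Longrightarrow> f x = \<one>) \<Longrightarrow> eval_word G f w = \<one>"
  by (induction w) (auto simp: eval_word_def)

text \<open>Test for a map on generators to respect cyclic relations. Moving the first letter to the
  end conjugates the product by that letter, which changes nothing if the product commutes with it;
  induction on the number of moves does the rest.\<close>

lemma eval_word_cyclic_relations:
  assumes f: "f \<in> X \<rightarrow> carrier G" and xs: "set xs \<subseteq> X"
    and comm: "\<And>x. x \<in> set xs \<Longrightarrow>
      eval_word G f (positive_word xs) \<otimes> f x = f x \<otimes> eval_word G f (positive_word xs)"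
    and r: "(r, r') \<in> cyclic_relations xs"
  shows "eval_word G f r = eval_word G f r'"
proof -
  let ?e = "\<lambda>ys. eval_word G f (positive_word ys)"
  obtain i where r: "r = positive_word xs" "r' = positive_word (rotate i xs)"
    using r by (auto simp: cyclic_relations_def)
  have "?e (rotate i xs) = ?e xs"
  proof (induction i)
    case (Suc i)
    show ?case
    proof (cases "rotate i xs")
      case (Cons y ys)
      have y: "y \<in> set xs" "set ys \<subseteq> set xs" using Cons set_rotate[of i xs] by auto
      then have c: "f y \<in> carrier G" "?e ys \<in> carrier G"
        using f xs by (auto intro!: eval_word_closed[OF f])
      have y1: "?e [y] = f y" using c by (simp add: positive_word_def eval_word_def)
      have yX: "y \<in> X" "set ys \<subseteq> X" using y xs by auto
      have 1: "?e xs = f y \<otimes> ?e ys"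
        using Suc Cons by (simp add: positive_word_def eval_word_def)
      have 2: "?e (rotate (Suc i) xs) = ?e ys \<otimes> f y"
        using Cons y xs yX by (simp add: positive_word_append eval_word_append[OF f] y1)
      \<comment> \<open>The left side is \<open>?e xs\<close> times \<open>f y\<close>, which
        \<open>comm\<close> turns around; cancelling the leading \<open>f y\<close> then gives the
        rotation step.\<close>
      have "f y \<otimes> (?e ys \<otimes> f y) = f y \<otimes> (f y \<otimes> ?e ys)"
        using comm[OF y(1)] c unfolding 1 by (simp add: m_assoc)
      then show ?thesis unfolding 2 unfolding 1 using c by simp
    qed (use Suc in simp)
  qed simp
  then show ?thesis by (simp add: r)
qed

end

section \<open>Commutation in presented groups\<close>

lemma gen_class_closed:
  "(\<lambda>x. word_class X R [(x, True)]) \<in> X \<rightarrow> carrier (presented_group X R)"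
  by (auto simp: carrier_presented_group)

text \<open>Evaluating at the classes of the generators is the quotient map, so facts about
  \<open>eval_word\<close> become facts about word classes.\<close>

lemma eval_word_gen_class:
  assumes "w \<in> words_over X"
  shows "eval_word (presented_group X R) (\<lambda>x. word_class X R [(x, True)]) w = word_class X R w"
  using assms
proof (induction w)
  case Nil
  then show ?case by (simp add: eval_word_def one_presented_group)
next
  case (Cons a w)
  interpret group "presented_group X R" by (rule group_presented_group)
  obtain x b where a: "a = (x, b)" by (cases a)
  have x: "x \<in> X" "w \<in> words_over X" using Cons a by auto
  have "([(x, False), (x, True)], []) \<in> word_cong X R"
    using word_cong.cancel[of x X "[]" "[]" False R] x by simp
  then have "word_class X R [(x, False)] \<otimes>\<^bsub>presented_group X R\<^esub> word_class X R [(x, True)]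
      = \<one>\<^bsub>presented_group X R\<^esub>"
    using x by (simp add: mult_presented_group one_presented_group word_class_eq_iff)
  then have "inv\<^bsub>presented_group X R\<^esub> word_class X R [(x, True)] = word_class X R [(x, False)]"
    using x by (intro inv_equality) (auto simp: carrier_presented_group)
  then show ?case
    using Cons x a by (auto simp: eval_word_def mult_presented_group)
qed

lemma word_class_commute:
  assumes "Y \<subseteq> X" "g \<in> carrier (presented_group X R)" "w \<in> words_over Y"
    and "\<And>y. y \<in> Y \<Longrightarrow> g \<otimes>\<^bsub>presented_group X R\<^esub> word_class X R [(y, True)]
      = word_class X R [(y, True)] \<otimes>\<^bsub>presented_group X R\<^esub> g"
  shows "g \<otimes>\<^bsub>presented_group X R\<^esub> word_class X R w
    = word_class X R w \<otimes>\<^bsub>presented_group X R\<^esub> g"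
proof -
  interpret group "presented_group X R" by (rule group_presented_group)
  have "w \<in> words_over X" using assms words_over_mono by blast
  then show ?thesis
    using eval_word_commute[of "\<lambda>x. word_class X R [(x, True)]" Y g w]
      gen_class_closed[of X R] assms by (auto simp: eval_word_gen_class)
qed

text \<open>Converse of the rotation test. If the word splits as p q, its relation says p q = q p,
  hence (p q) p = p (q p) = p (p q): the product commutes with every prefix, and each letter is a
  quotient of two consecutive prefixes.\<close>

lemma cyclic_relations_commute:
  assumes R: "cyclic_relations xs \<subseteq> R" and xs: "set xs \<subseteq> X" and x: "x \<in> set xs"
  shows "word_class X R (positive_word xs) \<otimes>\<^bsub>presented_group X R\<^esub> word_class X R [(x, True)]
    = word_class X R [(x, True)] \<otimes>\<^bsub>presented_group X R\<^esub> word_class X R (positive_word xs)"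
proof -
  interpret group "presented_group X R" by (rule group_presented_group)
  let ?c = "\<lambda>ys. word_class X R (positive_word ys)"
  have closed: "?c ys \<in> carrier (presented_group X R)" if "set ys \<subseteq> set xs" for ys
    using that xs by (auto simp: carrier_presented_group)
  have mult: "?c (ys @ zs) = ?c ys \<otimes>\<^bsub>presented_group X R\<^esub> ?c zs"
    if "set ys \<subseteq> set xs" "set zs \<subseteq> set xs" for ys zs
    using that xs by (simp add: positive_word_append mult_presented_group)
  have prefix: "?c xs \<otimes>\<^bsub>presented_group X R\<^esub> ?c (take i xs)
      = ?c (take i xs) \<otimes>\<^bsub>presented_group X R\<^esub> ?c xs" if "i \<le> length xs" for i
  \<comment> \<open>The full prefix is separate because \<open>cyclic_relations\<close> lists only
    rotations by less than the length; there the product merely commutes with itself.\<close>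
  proof (cases "i = length xs")
    case False
    then have i: "i < length xs" using that by simp
    have s: "set (take i xs) \<subseteq> set xs" "set (drop i xs) \<subseteq> set xs"
      by (auto dest: in_set_takeD in_set_dropD)
    have rot: "rotate i xs = drop i xs @ take i xs"
      using i by (simp add: rotate_drop_take)
    have rX: "set (rotate i xs) \<subseteq> X" using xs by simp
    have "(positive_word xs, positive_word (rotate i xs)) \<in> R"
      using i R by (auto simp: cyclic_relations_def)
    then have "(positive_word xs, positive_word (rotate i xs)) \<in> word_cong X R"
      using word_cong.rel[of "positive_word xs" "positive_word (rotate i xs)" R X "[]" "[]"] xs
      by simp
    then have "?c xs = ?c (rotate i xs)" using xs by (simp add: word_class_eq_iff)
    then have 1: "?c xs = ?c (drop i xs) \<otimes>\<^bsub>presented_group X R\<^esub> ?c (take i xs)"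
      unfolding rot using mult[OF s(2,1)] by simp
    have 2: "?c xs = ?c (take i xs) \<otimes>\<^bsub>presented_group X R\<^esub> ?c (drop i xs)"
      using mult[OF s(1,2)] by simp
    show ?thesis by (metis 1 2 closed[OF s(1)] closed[OF s(2)] m_assoc)
  qed (use closed in simp)
  obtain i where i: "i < length xs" "x = xs ! i" using x by (metis in_set_conv_nth)
  define p where "p = ?c (take i xs)"
  have s: "set (take i xs) \<subseteq> set xs" by (auto dest: in_set_takeD)
  have t: "take (Suc i) xs = take i xs @ [x]" using i by (simp add: take_Suc_conv_app_nth)
  have S: "?c (take (Suc i) xs) = p \<otimes>\<^bsub>presented_group X R\<^esub> ?c [x]"
    unfolding t p_def using mult[of "take i xs" "[x]"] s x by auto
  have p: "p \<in> carrier (presented_group X R)" unfolding p_def by (rule closed[OF s])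
  have c: "?c [x] \<in> carrier (presented_group X R)" "?c xs \<in> carrier (presented_group X R)"
    using x by (auto intro!: closed)
  have px: "?c xs \<otimes>\<^bsub>presented_group X R\<^esub> p = p \<otimes>\<^bsub>presented_group X R\<^esub> ?c xs"
    using prefix[of i] i by (simp add: p_def)
  have "?c xs \<otimes>\<^bsub>presented_group X R\<^esub> ?c [x] = ?c [x] \<otimes>\<^bsub>presented_group X R\<^esub> ?c xs"
  proof -
    have "?c [x] = inv\<^bsub>presented_group X R\<^esub> p \<otimes>\<^bsub>presented_group X R\<^esub> ?c (take (Suc i) xs)"
      unfolding S using p c by (simp add: m_assoc[symmetric])
    then show ?thesis
      using commute_mult[OF c(2) inv_closed[OF p] _ commute_inv[OF c(2) p px] prefix[of "Suc i"]]
        i S p c by simp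
  qed
  then show ?thesis by (simp add: positive_word_def)
qed


section \<open>Centers of free groups\<close>

definition flip :: "'a \<times> bool \<Rightarrow> 'a \<times> bool" where
  "flip a = (fst a, \<not> snd a)"

definition reduced :: "'a word \<Rightarrow> bool" where
  "reduced = successively (\<lambda>a b. b \<noteq> flip a)"

text \<open>Left multiplication by a letter, acting on reduced words. As in van der Waerden's
  argument, this action yields normal forms without a confluence proof.\<close>

definition push :: "'a \<times> bool \<Rightarrow> 'a word \<Rightarrow> 'a word" where
  "push a w = (if w \<noteq> [] \<and> hd w = flip a then tl w else a # w)"

lemma reduced_Cons: "reduced (a # w) \<longleftrightarrow> w = [] \<or> hd w \<noteq> flip a \<and> reduced w"
  by (auto simp: reduced_def successively_Cons)

lemma reduced_push: "reduced w \<Longrightarrow> reduced (push a w)"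
  by (cases w) (auto simp: push_def reduced_Cons, auto simp: reduced_def)

text \<open>A letter and its formal inverse act as mutually inverse permutations of the reduced
  words. Reducedness matters when \<open>push (flip a)\<close> deletes a leading \<open>a\<close>:
  the next letter must not be \<open>flip a\<close>, or \<open>push a\<close> would delete it
  instead of restoring \<open>a\<close>.\<close>

lemma push_flip: "reduced w \<Longrightarrow> push a (push (flip a) w) = w"
  by (cases w) (auto simp: push_def reduced_Cons flip_def prod_eq_iff)

lemma reduced_foldr_push: "reduced r \<Longrightarrow> reduced (foldr push w r)"
  by (induction w) (auto intro: reduced_push)

text \<open>Without relations only cancellations generate the congruence, and these act trivially by
  \<open>push_flip\<close>. Acting on the empty word therefore gives an invariant of the
  class.\<close>

lemma foldr_push_word_cong:
  assumes "(u, v) \<in> word_cong X {}" "reduced r"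
  shows "foldr push u r = foldr push v r"
  using assms
proof (induction rule: word_cong.induct)
  case (cancel x u v b)
  then show ?case
    using push_flip[of "foldr push v r" "(x, b)"] by (simp add: reduced_foldr_push flip_def)
qed auto

text \<open>Nothing cancels while a reduced word is rebuilt from the right. With the invariance
  above, congruent reduced words are equal.\<close>

lemma foldr_push_reduced: "reduced w \<Longrightarrow> foldr push w [] = w"
proof (induction w)
  case (Cons a w)
  then show ?case by (auto simp: reduced_Cons push_def)
qed simp

lemma push_word_cong:
  assumes "a # w \<in> words_over X"
  shows "(a # w, push a w) \<in> word_cong X R"
proof (cases "w \<noteq> [] \<and> hd w = flip a")
  case True
  then have "w = (fst a, \<not> snd a) # tl w" by (cases w) (auto simp: flip_def)
  then show ?thesis
    using True word_cong.cancel[of "fst a" X "[]" "tl w" "snd a" R] assms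
    by (auto simp: push_def) (metis words_over_Cons)
next
  case False
  then show ?thesis using assms by (auto simp: push_def intro: word_cong.refl)
qed

lemma foldr_push_word_class:
  "w \<in> words_over X \<Longrightarrow> (w, foldr push w []) \<in> word_cong X R"
proof (induction w)
  case (Cons a w)
  then have IH: "(w, foldr push w []) \<in> word_cong X R" by simp
  then have "(a # w, a # foldr push w []) \<in> word_cong X R"
    using word_cong_context[OF IH, of "[a]" "[]"] Cons by simp
  moreover have "(a # foldr push w [], push a (foldr push w [])) \<in> word_cong X R"
    using Cons.prems word_cong_words[OF IH] by (intro push_word_cong) simp
  ultimately show ?case by (auto intro: word_cong.trans)
qed (simp add: word_cong.refl)

text \<open>Left and right multiplication by a letter that does not cancel on the left of a
  nonempty reduced word give different reduced words.\<close>

lemma free_group_center_trivial: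
  assumes ab: "a \<in> X" "b \<in> X" "a \<noteq> b" and w: "w \<in> words_over X"
    and comm: "\<And>x. x \<in> X \<Longrightarrow> word_class X {} w \<otimes>\<^bsub>presented_group X {}\<^esub> word_class X {} [(x, True)]
      = word_class X {} [(x, True)] \<otimes>\<^bsub>presented_group X {}\<^esub> word_class X {} w"
  shows "(w, []) \<in> word_cong X {}"
proof -
  define v where "v = foldr push w []"
  have wv: "(w, v) \<in> word_cong X {}" using w by (simp add: v_def foldr_push_word_class)
  have v: "v \<in> words_over X" using word_cong_words[OF wv] by simp
  have rv: "reduced v" unfolding v_def by (rule reduced_foldr_push) (simp add: reduced_def)
  have "v = []"
  proof (rule ccontr)
    assume "v \<noteq> []"
    \<comment> \<open>Of the two distinct generators, one differs from the generator of the first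
      letter of \<open>v\<close>, so prefixing it cancels nothing.\<close>
    obtain x where x: "x \<in> X" "fst (hd v) \<noteq> x" using ab by metis
    have "word_class X {} w = word_class X {} v" using w v wv by (simp add: word_class_eq_iff)
    then have "(v @ [(x, True)], (x, True) # v) \<in> word_cong X {}"
      using comm[OF x(1)] v x by (simp add: mult_presented_group word_class_eq_iff)
    then have "foldr push (v @ [(x, True)]) [] = foldr push ((x, True) # v) []"
      by (rule foldr_push_word_cong) (simp add: reduced_def)
    moreover have "foldr push ((x, True) # v) [] = (x, True) # v"
      using x rv by (auto simp: foldr_push_reduced push_def flip_def)
    ultimately have *: "foldr push (v @ [(x, True)]) [] = (x, True) # v" by simp
    show False
    proof (cases "reduced (v @ [(x, True)])")
      case True
      then have "v @ [(x, True)] = (x, True) # v" using * by (simp only: foldr_push_reduced)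
      then have "hd v = (x, True)" using \<open>v \<noteq> []\<close> by (cases v) auto
      then show False using x by simp
    next
      \<comment> \<open>The appended letter now cancels the last letter of \<open>v\<close>, so one
        side is shorter than \<open>v\<close> while the other is longer.\<close>
      case False
      then have "(x, True) = flip (last v)"
        using rv by (auto simp: reduced_def successively_append_iff)
      then have "last v = (x, False)" by (auto simp: flip_def prod_eq_iff)
      then obtain u where u: "v = u @ [(x, False)]"
        using \<open>v \<noteq> []\<close> by (metis append_butlast_last_id)
      then have "reduced u" using rv by (auto simp: reduced_def successively_append_iff)
      then have "foldr push (v @ [(x, True)]) [] = u"
        by (simp add: u foldr_push_reduced push_def flip_def)
      then show False using * u by simp
    qed
  qed
  then show ?thesis using wv by simp
qed


section \<open>The direct product decomposition\<close>

abbreviation cls :: "nat \<Rightarrow> nat \<Rightarrow> gen word \<Rightarrow> gen word set" where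
  "cls m n \<equiv> word_class (G_gens m n) (G_rels m n)"

lemma set_ts: "set (ts m) = Gt ` {1..m}"
  by (auto simp: ts_def)

lemma set_us: "set (us n) = Gu ` {1..n}"
  by (auto simp: us_def)

lemma G_gens_eq: "G_gens m n = insert Gs (set (ts m) \<union> set (us n))"
  by (auto simp: G_gens_def set_ts set_us)

lemma group_Gmn: "group (Gmn m n)"
  by (simp add: Gmn_def group_presented_group)

lemma carrier_Gmn: "carrier (Gmn m n) = cls m n ` words_over (G_gens m n)"
  by (simp add: Gmn_def carrier_presented_group)

lemma cls_closed: "w \<in> words_over (G_gens m n) \<Longrightarrow> cls m n w \<in> carrier (Gmn m n)"
  by (simp add: carrier_Gmn)

lemma mult_cls:
  "u \<in> words_over (G_gens m n) \<Longrightarrow> v \<in> words_over (G_gens m n) \<Longrightarrow>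
    cls m n u \<otimes>\<^bsub>Gmn m n\<^esub> cls m n v = cls m n (u @ v)"
  by (simp add: Gmn_def mult_presented_group)

lemma Gmn_commute:
  assumes "cyclic_relations xs \<subseteq> G_rels m n" "set xs \<subseteq> G_gens m n" "x \<in> set xs"
  shows "cls m n (positive_word xs) \<otimes>\<^bsub>Gmn m n\<^esub> cls m n [(x, True)]
    = cls m n [(x, True)] \<otimes>\<^bsub>Gmn m n\<^esub> cls m n (positive_word xs)"
  using cyclic_relations_commute[OF assms] by (simp add: Gmn_def)

lemma ts_us_gen_commute:
  assumes "x \<in> set (ts m)" "y \<in> set (us n)"
  shows "cls m n [(x, True)] \<otimes>\<^bsub>Gmn m n\<^esub> cls m n [(y, True)]
    = cls m n [(y, True)] \<otimes>\<^bsub>Gmn m n\<^esub> cls m n [(x, True)]"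
proof -
  have X: "x \<in> G_gens m n" "y \<in> G_gens m n" using assms by (auto simp: G_gens_eq)
  have "(positive_word [x, y], positive_word (rotate 1 [x, y])) \<in> cyclic_relations [x, y]"
    unfolding cyclic_relations_def by (simp, rule exI[of _ 1]) auto
  moreover have "cyclic_relations [x, y] \<subseteq> G_rels m n"
    using assms by (auto simp: set_ts set_us G_rels_def)
  ultimately have "(positive_word [x, y], positive_word [y, x]) \<in> G_rels m n" by auto
  then have "([(x, True), (y, True)], [(y, True), (x, True)])
      \<in> word_cong (G_gens m n) (G_rels m n)"
    using word_cong.rel[of "positive_word [x, y]" "positive_word [y, x]" "G_rels m n"
        "G_gens m n" "[]" "[]"] X by (simp add: positive_word_def)
  then show ?thesis using X by (simp add: mult_cls word_class_eq_iff)
qed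

text \<open>Commutation is extended from letters to words twice: first each \<open>u_j\<close> past
  the whole word \<open>v\<close>, then \<open>v\<close> past the whole word
  \<open>w\<close>.\<close>

lemma ts_us_commute:
  assumes "v \<in> words_over (set (ts m))" "w \<in> words_over (set (us n))"
  shows "cls m n v \<otimes>\<^bsub>Gmn m n\<^esub> cls m n w = cls m n w \<otimes>\<^bsub>Gmn m n\<^esub> cls m n v"
proof -
  have sub: "set (ts m) \<subseteq> G_gens m n" "set (us n) \<subseteq> G_gens m n"
    by (auto simp: G_gens_eq)
  have v: "v \<in> words_over (G_gens m n)" using assms sub words_over_mono by blast
  have "cls m n [(y, True)] \<otimes>\<^bsub>Gmn m n\<^esub> cls m n v = cls m n v \<otimes>\<^bsub>Gmn m n\<^esub> cls m n [(y, True)]"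
    if "y \<in> set (us n)" for y
    unfolding Gmn_def
    by (rule word_class_commute[OF sub(1) _ assms(1)])
      (use that sub ts_us_gen_commute[of _ m y n] in \<open>auto simp: carrier_presented_group Gmn_def\<close>)
  then show ?thesis
    unfolding Gmn_def
    by (intro word_class_commute[OF sub(2) _ assms(2)])
      (use v in \<open>auto simp: carrier_presented_group Gmn_def\<close>)
qed

section \<open>The central element and the normal form\<close>

lemma Delta_closed: "Delta m n \<in> carrier (Gmn m n)"
  unfolding Delta_def by (rule cls_closed) (auto simp: G_gens_eq)

text \<open>The second bracketing holds since the product of the \<open>t_i\<close> commutes with
  that of the \<open>u_j\<close>. The first suits the \<open>t_i\<close>, the second the
  \<open>u_j\<close>, in the proof of centrality.\<close>

lemma Delta_eq:
  shows "Delta m n = cls m n (positive_word (Gs # ts m)) \<otimes>\<^bsub>Gmn m n\<^esub> cls m n (positive_word (us n))"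
    and "Delta m n = cls m n (positive_word (Gs # us n)) \<otimes>\<^bsub>Gmn m n\<^esub> cls m n (positive_word (ts m))"
proof -
  have sub: "insert Gs (set (ts m)) \<subseteq> G_gens m n" "insert Gs (set (us n)) \<subseteq> G_gens m n"
    by (auto simp: G_gens_eq)
  interpret group "Gmn m n" by (rule group_Gmn)
  have S: "cls m n (positive_word (Gs # xs))
      = cls m n [(Gs, True)] \<otimes>\<^bsub>Gmn m n\<^esub> cls m n (positive_word xs)"
    if "set xs \<subseteq> G_gens m n" for xs
    using that sub by (simp add: mult_cls) (simp add: positive_word_def)
  show 1: "Delta m n
      = cls m n (positive_word (Gs # ts m)) \<otimes>\<^bsub>Gmn m n\<^esub> cls m n (positive_word (us n))"
    using sub by (simp add: Delta_def mult_cls flip: positive_word_append)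
  show "Delta m n
      = cls m n (positive_word (Gs # us n)) \<otimes>\<^bsub>Gmn m n\<^esub> cls m n (positive_word (ts m))"
    unfolding 1 using sub ts_us_commute[of "positive_word (ts m)" m "positive_word (us n)" n]
    by (simp add: S m_assoc cls_closed)
qed

lemma Delta_central:
  assumes "g \<in> carrier (Gmn m n)"
  shows "Delta m n \<otimes>\<^bsub>Gmn m n\<^esub> g = g \<otimes>\<^bsub>Gmn m n\<^esub> Delta m n"
proof -
  interpret group "Gmn m n" by (rule group_Gmn)
  let ?D = "Delta m n" and ?c = "\<lambda>x. cls m n [(x, True)]" and ?p = "\<lambda>xs. cls m n (positive_word xs)"
  have sub: "set (Gs # ts m) \<subseteq> G_gens m n" "set (Gs # us n) \<subseteq> G_gens m n"
    by (auto simp: G_gens_eq)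
  have rels: "cyclic_relations (Gs # ts m) \<subseteq> G_rels m n" "cyclic_relations (Gs # us n) \<subseteq> G_rels m n"
    by (auto simp: G_rels_def)
  have gen: "?c x \<in> carrier (Gmn m n)" if "x \<in> G_gens m n" for x
    using that by (simp add: cls_closed)
  have pc: "?p (Gs # ts m) \<in> carrier (Gmn m n)" "?p (Gs # us n) \<in> carrier (Gmn m n)"
    "?p (ts m) \<in> carrier (Gmn m n)" "?p (us n) \<in> carrier (Gmn m n)"
    using sub by (auto intro!: cls_closed)
  note a = Gmn_commute[OF rels(1) sub(1), symmetric] and b = Gmn_commute[OF rels(2) sub(2), symmetric]
  have "?c x \<otimes>\<^bsub>Gmn m n\<^esub> ?D = ?D \<otimes>\<^bsub>Gmn m n\<^esub> ?c x" if x: "x \<in> G_gens m n" for x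
  proof -
    consider "x = Gs" | "x \<in> set (ts m)" | "x \<in> set (us n)" using x by (auto simp: G_gens_eq)
    then show ?thesis
    proof cases
      case 1
      \<comment> \<open>For the generator \<open>s\<close> neither bracketing works directly.
        Writing U as \<open>s\<close> inverse times \<open>s U\<close> makes Delta a product of
        \<open>s T\<close>, \<open>s\<close> inverse and \<open>s U\<close>, each commuting with
        \<open>s\<close>.\<close>
      have s: "?p (us n) = inv\<^bsub>Gmn m n\<^esub> ?c Gs \<otimes>\<^bsub>Gmn m n\<^esub> ?p (Gs # us n)"
      proof -
        have "?p (Gs # us n) = ?c Gs \<otimes>\<^bsub>Gmn m n\<^esub> ?p (us n)"
          using sub by (simp add: mult_cls) (simp add: positive_word_def)
        then show ?thesis using pc gen[of Gs] sub by (simp add: m_assoc[symmetric])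
      qed
      show ?thesis
        unfolding Delta_eq(1) s 1
        using a[of Gs] b[of Gs] pc gen[of Gs] sub
        by (intro commute_mult commute_inv) auto
    next
      case 2
      have "positive_word [x] \<in> words_over (set (ts m))" using 2 by simp
      from ts_us_commute[OF this, of "positive_word (us n)" n]
      have "?c x \<otimes>\<^bsub>Gmn m n\<^esub> ?p (us n) = ?p (us n) \<otimes>\<^bsub>Gmn m n\<^esub> ?c x"
        by (simp add: positive_word_def[of "[x]"])
      then show ?thesis
        unfolding Delta_eq(1) using a[of x] 2 pc gen[OF x] by (intro commute_mult) auto
    next
      case 3
      have "positive_word [x] \<in> words_over (set (us n))" using 3 by simp
      from ts_us_commute[OF _ this, of "positive_word (ts m)" m]
      have "?c x \<otimes>\<^bsub>Gmn m n\<^esub> ?p (ts m) = ?p (ts m) \<otimes>\<^bsub>Gmn m n\<^esub> ?c x"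
        by (simp add: positive_word_def[of "[x]"])
      then show ?thesis
        unfolding Delta_eq(2) using b[of x] 3 pc gen[OF x] by (intro commute_mult) auto
    qed
  qed
  moreover obtain w where "w \<in> words_over (G_gens m n)" "g = cls m n w"
    using assms by (auto simp: carrier_Gmn)
  ultimately show ?thesis
    using word_class_commute[OF order_refl, of ?D "G_gens m n" "G_rels m n" w] Delta_closed[of m n]
    by (simp add: Gmn_def)
qed

text \<open>The products of the stated shape are closed under multiplication, since Delta is central
  and the two families commute. They contain every generator and its inverse, hence every
  class.\<close>

lemma Gmn_decomposition:
  assumes "g \<in> carrier (Gmn m n)"
  shows "\<exists>(k::int) v w.
    g = Delta m n [^]\<^bsub>Gmn m n\<^esub> k \<otimes>\<^bsub>Gmn m n\<^esub> cls m n v \<otimes>\<^bsub>Gmn m n\<^esub> cls m n w \<and>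
    v \<in> words_over (set (ts m)) \<and> w \<in> words_over (set (us n))"
proof -
  interpret group "Gmn m n" by (rule group_Gmn)
  let ?D = "Delta m n"
  define N where "N = {?D [^]\<^bsub>Gmn m n\<^esub> k \<otimes>\<^bsub>Gmn m n\<^esub> cls m n v \<otimes>\<^bsub>Gmn m n\<^esub> cls m n w | (k::int) v w.
    v \<in> words_over (set (ts m)) \<and> w \<in> words_over (set (us n))}"
  have sub: "set (ts m) \<subseteq> G_gens m n" "set (us n) \<subseteq> G_gens m n"
    by (auto simp: G_gens_eq)
  note wo = words_over_mono[OF _ sub(1)] words_over_mono[OF _ sub(2)]
  note cl = wo[THEN cls_closed]
  note D = Delta_closed[of m n]
  have N_mult: "x \<otimes>\<^bsub>Gmn m n\<^esub> y \<in> N" if "x \<in> N" "y \<in> N" for x y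
  proof -
    obtain k v w where x: "v \<in> words_over (set (ts m))" "w \<in> words_over (set (us n))"
      "x = ?D [^]\<^bsub>Gmn m n\<^esub> (k::int) \<otimes>\<^bsub>Gmn m n\<^esub> cls m n v \<otimes>\<^bsub>Gmn m n\<^esub> cls m n w"
      using \<open>x \<in> N\<close> by (auto simp: N_def)
    obtain k' v' w' where y: "v' \<in> words_over (set (ts m))" "w' \<in> words_over (set (us n))"
      "y = ?D [^]\<^bsub>Gmn m n\<^esub> (k'::int) \<otimes>\<^bsub>Gmn m n\<^esub> cls m n v' \<otimes>\<^bsub>Gmn m n\<^esub> cls m n w'"
      using \<open>y \<in> N\<close> by (auto simp: N_def)
    define e where "e = ?D [^]\<^bsub>Gmn m n\<^esub> k'"
    have e: "e \<in> carrier (Gmn m n)" using D by (simp add: e_def)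
    have ec: "g \<otimes>\<^bsub>Gmn m n\<^esub> e = e \<otimes>\<^bsub>Gmn m n\<^esub> g" if "g \<in> carrier (Gmn m n)" for g
      unfolding e_def using that D by (intro commute_int_pow) (simp_all add: Delta_central)
    define d where "d = ?D [^]\<^bsub>Gmn m n\<^esub> k"
    have d: "d \<in> carrier (Gmn m n)" using D by (simp add: d_def)
    \<comment> \<open>Commutation restated for right-nested products, so that simplification can
      gather the powers of Delta, the \<open>t\<close>-words and the \<open>u\<close>-words.\<close>
    have swap: "p \<otimes>\<^bsub>Gmn m n\<^esub> (q \<otimes>\<^bsub>Gmn m n\<^esub> r) = q \<otimes>\<^bsub>Gmn m n\<^esub> (p \<otimes>\<^bsub>Gmn m n\<^esub> r)"
      if "p \<otimes>\<^bsub>Gmn m n\<^esub> q = q \<otimes>\<^bsub>Gmn m n\<^esub> p" "p \<in> carrier (Gmn m n)" "q \<in> carrier (Gmn m n)"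
        "r \<in> carrier (Gmn m n)" for p q r
      using that by (metis m_assoc)
    have c: "cls m n v \<in> carrier (Gmn m n)" "cls m n w \<in> carrier (Gmn m n)"
      "cls m n v' \<in> carrier (Gmn m n)" "cls m n w' \<in> carrier (Gmn m n)"
      using x y cl by auto
    have "x \<otimes>\<^bsub>Gmn m n\<^esub> y = (d \<otimes>\<^bsub>Gmn m n\<^esub> e) \<otimes>\<^bsub>Gmn m n\<^esub> (cls m n v \<otimes>\<^bsub>Gmn m n\<^esub> cls m n v')
        \<otimes>\<^bsub>Gmn m n\<^esub> (cls m n w \<otimes>\<^bsub>Gmn m n\<^esub> cls m n w')"
      unfolding x(3) y(3) e_def[symmetric] d_def[symmetric] using c d e
      by (simp add: m_assoc swap[OF ec] swap[OF ts_us_commute[OF y(1) x(2), symmetric]])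
    also have "\<dots> = ?D [^]\<^bsub>Gmn m n\<^esub> (k + k') \<otimes>\<^bsub>Gmn m n\<^esub> cls m n (v @ v') \<otimes>\<^bsub>Gmn m n\<^esub> cls m n (w @ w')"
      using x y D wo by (simp add: d_def e_def int_pow_mult mult_cls)
    also have "\<dots> \<in> N" unfolding N_def using x(1,2) y(1,2) by fastforce
    finally show ?thesis .
  qed
  have one: "cls m n [] = \<one>\<^bsub>Gmn m n\<^esub>" by (simp add: Gmn_def one_presented_group)
  have N_D: "?D [^]\<^bsub>Gmn m n\<^esub> k \<in> N" for k :: int
    using D unfolding N_def by (intro CollectI exI[of _ k] exI[of _ "[]"]) (simp add: one)
  have N_t: "cls m n v \<in> N" if "v \<in> words_over (set (ts m))" for v
    using that cl unfolding N_def
    by (intro CollectI exI[of _ 0] exI[of _ v] exI[of _ "[]"]) (simp add: one)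
  have N_u: "cls m n w \<in> N" if "w \<in> words_over (set (us n))" for w
    using that cl unfolding N_def
    by (intro CollectI exI[of _ 0] exI[of _ "[]"] exI[of _ w]) (simp add: one)
  have inv_cls: "inv\<^bsub>Gmn m n\<^esub> cls m n w = cls m n (inv_word w)" if "w \<in> words_over (G_gens m n)" for w
    using that inv_word_cancel[OF that, of "G_rels m n"] inv_word_words[OF that]
    by (intro inv_equality)
      (auto simp: mult_cls cls_closed word_class_eq_iff simp flip: one)
  let ?S = "cls m n [(Gs, True)]" and ?T = "cls m n (positive_word (ts m))"
    and ?U = "cls m n (positive_word (us n))"
  have Sw: "[(Gs, True)] \<in> words_over (G_gens m n)" "[(Gs, False)] \<in> words_over (G_gens m n)"
    by (auto simp: G_gens_eq)
  have SC: "?S \<in> carrier (Gmn m n)" using Sw by (intro cls_closed) auto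
  have TU: "?T \<in> carrier (Gmn m n)" "?U \<in> carrier (Gmn m n)"
    using cl by auto
  have "?D = ?S \<otimes>\<^bsub>Gmn m n\<^esub> ?T \<otimes>\<^bsub>Gmn m n\<^esub> ?U"
    using Sw sub by (simp add: mult_cls Delta_def) (simp add: positive_word_def)
  then have S: "?S = ?D \<otimes>\<^bsub>Gmn m n\<^esub> inv\<^bsub>Gmn m n\<^esub> ?U \<otimes>\<^bsub>Gmn m n\<^esub> inv\<^bsub>Gmn m n\<^esub> ?T"
    using SC TU by (simp add: m_assoc)
  have S': "inv\<^bsub>Gmn m n\<^esub> ?S = ?T \<otimes>\<^bsub>Gmn m n\<^esub> ?U \<otimes>\<^bsub>Gmn m n\<^esub> inv\<^bsub>Gmn m n\<^esub> ?D"
    unfolding S using SC TU D by (simp add: inv_mult_group m_assoc)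
  have N_s: "cls m n [(Gs, b)] \<in> N" for b
  proof (cases b)
    case True
    have "inv\<^bsub>Gmn m n\<^esub> ?U \<in> N" "inv\<^bsub>Gmn m n\<^esub> ?T \<in> N"
      using sub N_t[OF inv_word_words, of "positive_word (ts m)"]
        N_u[OF inv_word_words, of "positive_word (us n)"] by (auto simp: inv_cls)
    then have "?S \<in> N" unfolding S using N_D[of 1] D by (auto intro!: N_mult)
    then show ?thesis using True by simp
  next
    case False
    have "inv\<^bsub>Gmn m n\<^esub> ?D \<in> N" using N_D[of "-1"] D by (simp add: int_pow_neg)
    then have "inv\<^bsub>Gmn m n\<^esub> ?S \<in> N" unfolding S' by (intro N_mult N_t[of "positive_word (ts m)"] N_u) auto
    then show ?thesis using False Sw by (simp add: inv_cls inv_word_def)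
  qed
  have "cls m n w \<in> N" if "w \<in> words_over (G_gens m n)" for w
    using that
  proof (induction w)
    case Nil
    then show ?case by (intro N_t) simp
  next
    case (Cons a w)
    then have "fst a = Gs \<or> fst a \<in> set (ts m) \<or> fst a \<in> set (us n)"
      unfolding G_gens_eq by simp
    then have "cls m n [a] \<in> N"
      using N_s[of "snd a"] N_t[of "[a]"] N_u[of "[a]"] by (cases a) auto
    then have "cls m n [a] \<otimes>\<^bsub>Gmn m n\<^esub> cls m n w \<in> N" using Cons by (intro N_mult) auto
    then show ?case using Cons by (simp add: mult_cls)
  qed
  then have "g \<in> N" using assms by (auto simp: carrier_Gmn)
  then show ?thesis unfolding N_def mem_Collect_eq .
qed


section \<open>Separating the factors\<close>

text \<open>Projection onto one free factor, with \<open>xs\<close> covering both cases. Generators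
  in \<open>xs\<close> are kept, those of the other family go to the identity, and \<open>s\<close>
  goes to the inverse of the product \<open>c\<close> of \<open>xs\<close>, so that Delta goes to
  the identity.\<close>

lemma Gmn_hom_free:
  assumes xs: "xs = ts m \<or> xs = us n"
  obtains h where "h \<in> hom (Gmn m n) (presented_group (set xs) {})"
    and "\<And>w. w \<in> words_over (set xs) \<Longrightarrow> h (cls m n w) = word_class (set xs) {} w"
    and "\<And>w. w \<in> words_over (G_gens m n - {Gs} - set xs) \<Longrightarrow>
      h (cls m n w) = \<one>\<^bsub>presented_group (set xs) {}\<^esub>"
    and "h (Delta m n) = \<one>\<^bsub>presented_group (set xs) {}\<^esub>"
proof -
  let ?F = "presented_group (set xs) {}" and ?X = "G_gens m n"
  interpret F: group ?F by (rule group_presented_group)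
  define c where "c = word_class (set xs) {} (positive_word xs)"
  define f where "f x = (if x = Gs then inv\<^bsub>?F\<^esub> c
    else if x \<in> set xs then word_class (set xs) {} [(x, True)] else \<one>\<^bsub>?F\<^esub>)" for x
  have Gs: "Gs \<notin> set (ts m)" "Gs \<notin> set (us n)" "Gs \<notin> set xs" using xs by (auto simp: set_ts set_us)
  have disj: "set (ts m) \<inter> set (us n) = {}" by (auto simp: set_ts set_us)
  have sub: "set xs \<subseteq> ?X" using xs by (auto simp: G_gens_eq)
  have c: "c \<in> carrier ?F" by (auto simp: c_def carrier_presented_group)
  have f: "f \<in> ?X \<rightarrow> carrier ?F" 
  proof
    fix x
    have "word_class (set xs) {} [(x, True)] \<in> carrier ?F" if "x \<in> set xs"
      using that by (simp add: carrier_presented_group)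
    then show "f x \<in> carrier ?F" using c by (simp add: f_def)
  qed
  have ev_in: "eval_word ?F f w = word_class (set xs) {} w" if "w \<in> words_over (set xs)" for w
  proof -
    have "eval_word ?F f w = eval_word ?F (\<lambda>x. word_class (set xs) {} [(x, True)]) w"
      using that
    proof (induction w)
      case (Cons a w)
      then have "f (fst a) = word_class (set xs) {} [(fst a, True)]" using Gs by (auto simp: f_def)
      then show ?case using Cons by (cases a) (auto simp: eval_word_def)
    qed (simp add: eval_word_def)
    then show ?thesis using that by (simp add: eval_word_gen_class)
  qed
  have ev_out: "eval_word ?F f w = \<one>\<^bsub>?F\<^esub>" if "w \<in> words_over (?X - {Gs} - set xs)" for w
    using that by (rule F.eval_word_trivial) (auto simp: f_def)
  have ev_Cons: "eval_word ?F f (positive_word (y # ys)) = f y \<otimes>\<^bsub>?F\<^esub> eval_word ?F f (positive_word ys)" for y ys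
    by (simp add: eval_word_def positive_word_def)
  \<comment> \<open>For the family kept, the product is \<open>c\<close> inverse times
    \<open>c\<close>, the identity. For the other family it is the image of \<open>s\<close>, and
    the remaining letters are trivial.\<close>
  have star: "eval_word ?F f (positive_word (Gs # ys)) \<otimes>\<^bsub>?F\<^esub> f x
      = f x \<otimes>\<^bsub>?F\<^esub> eval_word ?F f (positive_word (Gs # ys))"
    if ys: "ys = ts m \<or> ys = us n" and x: "x \<in> set (Gs # ys)" for ys x
  proof (cases "ys = xs")
    case True
    have "f x \<in> carrier ?F" using f x ys by (auto simp: G_gens_eq)
    moreover have "eval_word ?F f (positive_word (Gs # ys)) = \<one>\<^bsub>?F\<^esub>"
      using c by (simp add: ev_Cons ev_in True f_def[of Gs] flip: c_def)
    ultimately show ?thesis by simp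
  next
    case False
    then have d: "set ys \<subseteq> ?X - {Gs} - set xs" using xs ys disj Gs by (auto simp: G_gens_eq)
    then have "eval_word ?F f (positive_word (Gs # ys)) = f Gs"
      using c by (simp add: ev_Cons ev_out f_def[of Gs])
    moreover have "f x = f Gs \<or> f x = \<one>\<^bsub>?F\<^esub>" using d x by (auto simp: f_def)
    moreover have "f Gs \<in> carrier ?F" using c by (simp add: f_def)
    ultimately show ?thesis by auto
  qed
  have pair: "eval_word ?F f (positive_word [x, y]) \<otimes>\<^bsub>?F\<^esub> f z
      = f z \<otimes>\<^bsub>?F\<^esub> eval_word ?F f (positive_word [x, y])"
    if "x \<in> set (ts m)" "y \<in> set (us n)" "z \<in> set [x, y]" for x y z
  proof -
    \<comment> \<open>The two families are disjoint, so at least one of the two letters is sent to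
      the identity.\<close>
    have "x \<notin> set xs \<or> y \<notin> set xs" using disj that xs by auto
    moreover have "x \<noteq> Gs" "y \<noteq> Gs" using that Gs by auto
    ultimately have "f x = \<one>\<^bsub>?F\<^esub> \<or> f y = \<one>\<^bsub>?F\<^esub>" by (auto simp: f_def)
    moreover have "f x \<in> carrier ?F" "f y \<in> carrier ?F" using f that by (auto simp: G_gens_eq)
    ultimately show ?thesis using that by (auto simp: eval_word_def positive_word_def)
  qed
  have rel: "eval_word ?F f r = eval_word ?F f r'" if "(r, r') \<in> G_rels m n" for r r'
  proof -
    consider "(r, r') \<in> cyclic_relations (Gs # ts m)" | "(r, r') \<in> cyclic_relations (Gs # us n)"
      | x y where "x \<in> set (ts m)" "y \<in> set (us n)" "(r, r') \<in> cyclic_relations [x, y]"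
      using \<open>(r, r') \<in> G_rels m n\<close> by (auto simp: G_rels_def set_ts set_us)
    then show ?thesis
    proof cases
      case 1
      show ?thesis
        by (rule F.eval_word_cyclic_relations[OF f _ star 1]) (auto simp: G_gens_eq)
    next
      case 2
      show ?thesis
        by (rule F.eval_word_cyclic_relations[OF f _ star 2]) (auto simp: G_gens_eq)
    next
      case 3
      then show ?thesis
        by (intro F.eval_word_cyclic_relations[OF f _ pair[OF 3(1,2)] 3(3)]) (auto simp: G_gens_eq)
    qed
  qed
  have "\<exists>h\<in>hom (Gmn m n) ?F. \<forall>w\<in>words_over ?X. h (cls m n w) = eval_word ?F f w"
    unfolding Gmn_def by (rule F.presented_group_hom[OF f]) (rule rel)
  then obtain h where h: "h \<in> hom (Gmn m n) ?F"
    "\<And>w. w \<in> words_over ?X \<Longrightarrow> h (cls m n w) = eval_word ?F f w"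
    by blast
  show thesis
  proof (rule that[OF h(1)])
    show "h (cls m n w) = word_class (set xs) {} w" if "w \<in> words_over (set xs)" for w
      using that sub by (simp add: h(2) ev_in words_over_mono)
    show "h (cls m n w) = \<one>\<^bsub>?F\<^esub>" if "w \<in> words_over (?X - {Gs} - set xs)" for w
    proof -
      have "w \<in> words_over ?X" by (rule words_over_mono[OF that]) auto
      then show ?thesis by (simp add: h(2) ev_out[OF that])
    qed
    have ys: "eval_word ?F f (positive_word (ts m @ us n)) = c"
    proof -
      have s: "set (ts m) \<subseteq> ?X" "set (us n) \<subseteq> ?X" by (auto simp: G_gens_eq)
      have "eval_word ?F f (positive_word ys) = (if ys = xs then c else \<one>\<^bsub>?F\<^esub>)"
        if "ys = ts m \<or> ys = us n" for ys
      proof (cases "ys = xs")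
        case False
        then have "set ys \<subseteq> ?X - {Gs} - set xs" using xs that disj Gs by (auto simp: G_gens_eq)
        then show ?thesis using False by (simp add: ev_out)
      qed (simp add: ev_in c_def)
      \<comment> \<open>Both families can coincide with \<open>xs\<close> only if both are empty;
        the product would then read \<open>c\<close> twice, which is harmless because
        \<open>c\<close> is the identity.\<close>
      moreover have "xs = ts m \<and> xs = us n \<Longrightarrow> c = \<one>\<^bsub>?F\<^esub>"
        using disj by (auto simp: c_def positive_word_def one_presented_group)
      ultimately show ?thesis
        using xs s c by (auto simp: positive_word_append F.eval_word_append[OF f])
    qed
    show "h (Delta m n) = \<one>\<^bsub>?F\<^esub>"
      using c unfolding Delta_def
      by (subst h(2)) (auto simp: ev_Cons ys f_def[of Gs] G_gens_eq)
  qed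
qed

text \<open>The exponent sum of \<open>s\<close>. All cyclic relations hold in an abelian group, and
  Delta contains \<open>s\<close> exactly once.\<close>

lemma Gmn_hom_int:
  obtains h where "h \<in> hom (Gmn m n) integer_group" "h (Delta m n) = 1"
proof -
  interpret Z: comm_group integer_group by (rule abelian_integer_group)
  define f where "f x = (if x = Gs then 1 else (0::int))" for x
  have f: "f \<in> X \<rightarrow> carrier integer_group" for X by simp
  have rel: "eval_word integer_group f r = eval_word integer_group f r'"
    if "(r, r') \<in> G_rels m n" for r r'
  proof -
    obtain xs where "(r, r') \<in> cyclic_relations xs"
      using \<open>(r, r') \<in> G_rels m n\<close> by (auto simp: G_rels_def)
    then show ?thesis by (intro Z.eval_word_cyclic_relations[OF f order_refl]) auto
  qed
  have "\<exists>h\<in>hom (Gmn m n) integer_group.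
      \<forall>w\<in>words_over (G_gens m n). h (cls m n w) = eval_word integer_group f w"
    unfolding Gmn_def by (rule Z.presented_group_hom[OF f]) (rule rel)
  then obtain h where h: "h \<in> hom (Gmn m n) integer_group"
    "\<And>w. w \<in> words_over (G_gens m n) \<Longrightarrow> h (cls m n w) = eval_word integer_group f w"
    by blast
  have "eval_word integer_group f (positive_word (ts m @ us n)) = \<one>\<^bsub>integer_group\<^esub>"
    by (rule Z.eval_word_trivial[of _ "set (ts m @ us n)"]) (auto simp: f_def set_ts set_us)
  then have "eval_word integer_group f (positive_word (Gs # ts m @ us n)) = 1"
    by (simp add: eval_word_def positive_word_def f_def)
  moreover have "positive_word (Gs # ts m @ us n) \<in> words_over (G_gens m n)"
    by (auto simp: G_gens_eq)
  ultimately show thesis using that[OF h(1)] h(2) by (simp add: Delta_def)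
qed

section \<open>Determination of the center\<close>

text \<open>The projection sends \<open>z\<close> to the class of \<open>v\<close> and hits all free
  generators, so that class is central in a free group of rank at least two and hence
  trivial.\<close>

lemma central_factor_trivial:
  assumes xs: "xs = ts m \<or> xs = us n" and ab: "a \<in> set xs" "b \<in> set xs" "a \<noteq> b"
    and z: "z \<in> center (Gmn m n)" and v: "v \<in> words_over (set xs)"
    and d: "w \<in> words_over (G_gens m n - {Gs} - set xs)"
    and z_eq: "z = Delta m n [^]\<^bsub>Gmn m n\<^esub> (k::int) \<otimes>\<^bsub>Gmn m n\<^esub> (cls m n v \<otimes>\<^bsub>Gmn m n\<^esub> cls m n w)"
  shows "cls m n v = \<one>\<^bsub>Gmn m n\<^esub>"
proof -
  let ?F = "presented_group (set xs) {}"
  interpret G: group "Gmn m n" by (rule group_Gmn)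
  interpret F: group ?F by (rule group_presented_group)
  obtain h where h: "h \<in> hom (Gmn m n) ?F"
    "\<And>w. w \<in> words_over (set xs) \<Longrightarrow> h (cls m n w) = word_class (set xs) {} w"
    "\<And>w. w \<in> words_over (G_gens m n - {Gs} - set xs) \<Longrightarrow> h (cls m n w) = \<one>\<^bsub>?F\<^esub>"
    "h (Delta m n) = \<one>\<^bsub>?F\<^esub>"
    using Gmn_hom_free[OF xs] by blast
  interpret h: group_hom "Gmn m n" ?F h by unfold_locales (rule h(1))
  have sub: "set xs \<subseteq> G_gens m n" using xs by (auto simp: G_gens_eq)
  have vG: "v \<in> words_over (G_gens m n)" using v sub words_over_mono by blast
  have wG: "w \<in> words_over (G_gens m n)" by (rule words_over_mono[OF d]) auto
  have cv: "word_class (set xs) {} v \<in> carrier ?F" using v by (simp add: carrier_presented_group)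
  have "h (Delta m n [^]\<^bsub>Gmn m n\<^esub> k) = \<one>\<^bsub>?F\<^esub>"
    using Delta_closed h(4) by (simp add: h.hom_int_pow)
  then have hz: "h z = word_class (set xs) {} v"
    unfolding z_eq using Delta_closed vG wG v d h(2,3) cv by (simp add: cls_closed)
  have "(v, []) \<in> word_cong (set xs) {}"
  proof (rule free_group_center_trivial[OF ab v])
    fix x assume x: "x \<in> set xs"
    then have xw: "[(x, True)] \<in> words_over (set xs)" by simp
    have c: "cls m n [(x, True)] \<in> carrier (Gmn m n)" using x sub by (auto intro!: cls_closed)
    have "z \<in> carrier (Gmn m n)" using z by (simp add: center_def)
    moreover have "z \<otimes>\<^bsub>Gmn m n\<^esub> cls m n [(x, True)] = cls m n [(x, True)] \<otimes>\<^bsub>Gmn m n\<^esub> z"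
      using z c by (simp add: center_def)
    ultimately show "word_class (set xs) {} v \<otimes>\<^bsub>?F\<^esub> word_class (set xs) {} [(x, True)]
      = word_class (set xs) {} [(x, True)] \<otimes>\<^bsub>?F\<^esub> word_class (set xs) {} v"
      using c h.hom_mult h(2)[OF xw] hz by metis
  qed
  \<comment> \<open>The free cancellations that reduce \<open>v\<close> to the empty word are valid
    in \<open>Gmn\<close> too.\<close>
  then have "(v, []) \<in> word_cong (G_gens m n) (G_rels m n)"
    using sub by (rule word_cong_mono) simp
  then show ?thesis using vG by (simp add: Gmn_def one_presented_group word_class_eq_iff)
qed

theorem proposition5p4:
  fixes m n :: nat
  assumes "m \<ge> 2" and "n \<ge> 2"
  shows "(Gmn m n)\<lparr>carrier := center (Gmn m n)\<rparr> \<cong> integer_group \<and>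
    center (Gmn m n) = generate (Gmn m n) {Delta m n}"
proof -
  interpret group "Gmn m n" by (rule group_Gmn)
  let ?G = "Gmn m n" and ?D = "Delta m n"
  note D = Delta_closed[of m n]
  have gen: "generate ?G {?D} = range (\<lambda>k::int. ?D [^]\<^bsub>?G\<^esub> k)"
    using generate_pow[OF D] by auto
  have "z \<in> range (\<lambda>k::int. ?D [^]\<^bsub>?G\<^esub> k)" if z: "z \<in> center ?G" for z
  proof -
    have zc: "z \<in> carrier ?G" using z by (simp add: center_def)
    obtain k v w where vw: "v \<in> words_over (set (ts m))" "w \<in> words_over (set (us n))"
      and z_eq: "z = ?D [^]\<^bsub>?G\<^esub> (k::int) \<otimes>\<^bsub>?G\<^esub> cls m n v \<otimes>\<^bsub>?G\<^esub> cls m n w"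
      using Gmn_decomposition[OF zc] by blast
    have sub: "set (ts m) \<subseteq> G_gens m n - {Gs} - set (us n)"
      "set (us n) \<subseteq> G_gens m n - {Gs} - set (ts m)"
      by (auto simp: G_gens_eq set_ts set_us)
    have vw': "v \<in> words_over (G_gens m n - {Gs} - set (us n))"
      "w \<in> words_over (G_gens m n - {Gs} - set (ts m))"
      using vw sub words_over_mono by blast+
    have c: "cls m n v \<in> carrier ?G" "cls m n w \<in> carrier ?G"
      by (intro cls_closed words_over_mono[OF vw(1)] words_over_mono[OF vw(2)],
          use sub in blast)+
    have z1: "z = ?D [^]\<^bsub>?G\<^esub> k \<otimes>\<^bsub>?G\<^esub> (cls m n v \<otimes>\<^bsub>?G\<^esub> cls m n w)"
      using z_eq c D by (simp add: m_assoc)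
    \<comment> \<open>The same element with the two factors exchanged, so that the one-factor lemma
      also applies to \<open>w\<close>.\<close>
    have z2: "z = ?D [^]\<^bsub>?G\<^esub> k \<otimes>\<^bsub>?G\<^esub> (cls m n w \<otimes>\<^bsub>?G\<^esub> cls m n v)"
      using z1 ts_us_commute[OF vw] by simp
    have "cls m n v = \<one>\<^bsub>?G\<^esub>"
      using assms
      by (intro central_factor_trivial[OF _ _ _ _ z vw(1) vw'(2) z1, of "Gt 1" "Gt 2"])
        (auto simp: set_ts)
    moreover have "cls m n w = \<one>\<^bsub>?G\<^esub>"
      using assms
      by (intro central_factor_trivial[OF _ _ _ _ z vw(2) vw'(1) z2, of "Gu 1" "Gu 2"])
        (auto simp: set_us)
    ultimately show ?thesis using z1 D by simp
  qed
  moreover have "?D [^]\<^bsub>?G\<^esub> (k::int) \<in> center ?G" for k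
    using D commute_int_pow[of _ ?D k] by (auto simp: center_def Delta_central)
  ultimately have center: "center ?G = range (\<lambda>k::int. ?D [^]\<^bsub>?G\<^esub> k)" by blast
  obtain h where h: "h \<in> hom ?G integer_group" "h ?D = 1" by (rule Gmn_hom_int)
  interpret h: group_hom ?G integer_group h
    by (intro group_hom.intro group_hom_axioms.intro group_axioms group_integer_group h(1))
  \<comment> \<open>The homomorphism is a left inverse of the power map, which is therefore
    injective.\<close>
  have "h (?D [^]\<^bsub>?G\<^esub> k) = k" for k :: int
    using D h(2) by (simp add: h.hom_int_pow)
  then have "inj (\<lambda>k::int. ?D [^]\<^bsub>?G\<^esub> k)" by (metis injI)
  then have "(\<lambda>k::int. ?D [^]\<^bsub>?G\<^esub> k) \<in> iso integer_group (?G\<lparr>carrier := center ?G\<rparr>)"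
    using D by (auto simp: iso_def bij_betw_def center int_pow_mult intro!: homI)
  then have "?G\<lparr>carrier := center ?G\<rparr> \<cong> integer_group"
    by (intro group.iso_sym[OF group_integer_group]) (auto simp: is_iso_def)
  then show ?thesis using center gen by simp
qed

end
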